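(* Let $G$ be a finite tree with a proper edge coloring $\kappa:E(G)\to[k]$. If $\mathfrak{G}_\kappa$ is a generalized toggle group, then for every path in $G$ (with distinct vertices) having at least two edges, the word obtained by reading the edge colors along the path is a toggle word.
   Context: A proper edge coloring of $G$ on $k$ colors is a surjective map $\kappa:E(G)\to[k]$ such that edges sharing a vertex receive different colors. For $a\in[k]$, $\tau_a\in S_{V(G)}$ is the product of the transpositions $(i,j)$ over all edges $\{i,j\}$ colored $a$, and $\mathfrak{G}_\kappa\le S_{V(G)}$ is generated by $\tau_1,\dots,\tau_k$. Toggles: for a finite set $E$ and $L\subseteq 2^E$, $t_e$ ($e\in E$) is the permutation of $L$ with $t_e(X)=X\cup\{e\}$ if $e\notin X$ and $X\cup\{e\}\in L$, $t_e(X)=X\setminus\{e\}$ if $e\in X$ and $X\setminus\{e\}\in L$, and $t_e(X)=X$ otherwise. "$\mathfrak{G}_\kappa$ is a generalized toggle group" means: there exist a finite set $E$, $L\subseteq 2^E$, a bijection $\varphi:V(G)\to L$ and an injective map $c:[k]\to E$ such that for all distinct $u,v\in V(G)$ and $a\in[k]$, $\{u,v\}$ is an edge colored $a$ iff the symmetric difference of $\varphi(u)$ and $\varphi(v)$ is $\{c(a)\}$, and every $e\in E$ with $t_e\neq\mathrm{id}$ is in the image of $c$. A word $w\in[k]^\ell$ with $\ell\ge 2$ is a toggle word if every contiguous subword of $w$ of length at least $2$ has at least two distinct letters each occurring an odd number of times in that subword. *)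

theory Defs
  imports "Graph_Theory.Graph_Theory" "HOL-Library.Sublist" "HOL-Combinatorics.Permutations"
begin

text \<open>
  A finite simple graph is a \<^locale>\<open>pair_graph\<close>: a finite loop-free digraph whose set of arcs
  is a symmetric relation. Its undirected edges are the two-element sets of end points.
\<close>

definition edges :: "'v pair_pre_digraph \<Rightarrow> 'v set set" where
  "edges G = {{u, v} | u v. (u, v) \<in> parcs G}"

text \<open>
  The library predicate \<^const>\<open>tree\<close> forbids directed cycles, so for a symmetric digraph it already
  fails on a single edge \<open>u, v, u\<close>. Closed walks without repeated vertices of length at least three
  are exactly the cycles of the undirected graph.
\<close>

definition undirected_tree :: "'v pair_pre_digraph \<Rightarrow> bool" where
  "undirected_tree G \<longleftrightarrow>
     pair_graph G \<and> connected (with_proj G) \<and>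
     \<not> (\<exists>p. pre_digraph.cycle (with_proj G) p \<and> length p \<ge> 3)"

text \<open>The colour set \<open>[k]\<close> is \<open>{1..k}\<close>; values of \<open>\<kappa>\<close> on sets that are not edges are irrelevant.\<close>

definition proper_edge_coloring :: "'v pair_pre_digraph \<Rightarrow> nat \<Rightarrow> ('v set \<Rightarrow> nat) \<Rightarrow> bool" where
  "proper_edge_coloring G k \<kappa> \<longleftrightarrow>
     \<kappa> ` edges G = {1..k} \<and>
     (\<forall>e \<in> edges G. \<forall>f \<in> edges G. e \<noteq> f \<and> e \<inter> f \<noteq> {} \<longrightarrow> \<kappa> e \<noteq> \<kappa> f)"

text \<open>
  As a function on all sets, the toggle is extended by the identity outside \<open>L\<close>, so that
  \<open>toggle L x = id\<close> says that the permutation of \<open>L\<close> is trivial.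
\<close>

definition toggle :: "'e set set \<Rightarrow> 'e \<Rightarrow> 'e set \<Rightarrow> 'e set" where
  "toggle L x X =
     (if X \<notin> L then X
      else if x \<notin> X \<and> X \<union> {x} \<in> L then X \<union> {x}
      else if x \<in> X \<and> X - {x} \<in> L then X - {x}
      else X)"

lemma toggle_toggle: "toggle L x (toggle L x X) = X"
  by (auto simp: toggle_def insert_absorb)

lemma toggle_permutes: "toggle L x permutes L"
  unfolding permutes_def
proof (intro conjI allI impI)
  show "toggle L x X = X" if "X \<notin> L" for X
    using that by (simp add: toggle_def)
  show "\<exists>!X. toggle L x X = Y" for Y
    by (metis toggle_toggle)
qed

text \<open>
  Being a generalized toggle group is a condition on the coloured graph, namely that the generators
  \<open>\<tau>\<^sub>a\<close> are carried to toggles; the abstract group they generate does not enter. The ground set \<open>E\<close>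
  ranges over the finite sets of the type given by the first argument.
\<close>

definition generalized_toggle_group ::
    "'e itself \<Rightarrow> 'v pair_pre_digraph \<Rightarrow> nat \<Rightarrow> ('v set \<Rightarrow> nat) \<Rightarrow> bool" where
  "generalized_toggle_group _ G k \<kappa> \<longleftrightarrow>
     (\<exists>(E :: 'e set) L \<phi> c.
        finite E \<and> L \<subseteq> Pow E \<and> bij_betw \<phi> (pverts G) L \<and>
        c ` {1..k} \<subseteq> E \<and> inj_on c {1..k} \<and>
        (\<forall>u \<in> pverts G. \<forall>v \<in> pverts G. \<forall>a \<in> {1..k}. u \<noteq> v \<longrightarrow>
           ({u, v} \<in> edges G \<and> \<kappa> {u, v} = a \<longleftrightarrow> sym_diff (\<phi> u) (\<phi> v) = {c a})) \<and>
        (\<forall>x \<in> E. toggle L x \<noteq> id \<longrightarrow> x \<in> c ` {1..k}))"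

definition toggle_word :: "nat \<Rightarrow> nat list \<Rightarrow> bool" where
  "toggle_word k w \<longleftrightarrow>
     set w \<subseteq> {1..k} \<and> length w \<ge> 2 \<and>
     (\<forall>s. sublist s w \<and> length s \<ge> 2 \<longrightarrow>
        (\<exists>a b. a \<noteq> b \<and> odd (count_list s a) \<and> odd (count_list s b)))"

definition path_word :: "('v set \<Rightarrow> nat) \<Rightarrow> 'v vwalk \<Rightarrow> nat list" where
  "path_word \<kappa> p = map (\<lambda>(u, v). \<kappa> {u, v}) (vwalk_arcs p)"

end

(* Crossing an edge coloured a changes phi by the single element c(a), so along a walk the two ends
   differ exactly in the elements c(a) whose colour a is read an odd number of times. On a path with
   at least two edges no odd colour would make the ends equal, and exactly one odd colour would make
   them adjacent, closing a cycle. *)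
theory Submission
  imports Defs
begin

lemma path_word_drop: "path_word \<kappa> (drop n p) = drop n (path_word \<kappa> p)"
proof (induction n arbitrary: p)
  case (Suc n)
  then show ?case
    by (metis drop_Suc map_tl path_word_def vwalk_arcs_tl)
qed simp

text \<open>A walk with \<open>Suc n\<close> vertices has \<open>n\<close> edges, hence the shift
  between the two sides.\<close>

lemma path_word_take: "path_word \<kappa> (take (Suc n) p) = take n (path_word \<kappa> p)"
proof (induction p arbitrary: n rule: vwalk_arcs.induct)
  case (3 x y xs)
  then show ?case
    by (cases n) (auto simp: path_word_def)
qed (auto simp: path_word_def)

text \<open>A contiguous subword is a \<open>take\<close> of a \<open>drop\<close>, and both commute
  with \<open>path_word\<close>. This lets the condition on all subwords be checked on
  subpaths.\<close>

lemma sublist_path_word: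
  assumes "sublist s (path_word \<kappa> p)"
  obtains q where "sublist q p" "path_word \<kappa> q = s"
proof -
  obtain xs ys where "path_word \<kappa> p = xs @ s @ ys"
    using assms by (auto simp: sublist_def)
  then have "s = take (length s) (drop (length xs) (path_word \<kappa> p))"
    by simp
  also have "\<dots> = path_word \<kappa> (take (Suc (length s)) (drop (length xs) p))"
    by (simp add: path_word_take path_word_drop)
  finally show thesis
    using that by (metis sublist_drop sublist_order.order_trans sublist_take)
qed

lemma length_path_word: "length (path_word \<kappa> p) = length p - 1"
  by (metis length_map path_word_def vwalk_length_def vwalk_length_simp)

lemma vpath_sublist:
  assumes "vpath p G" "sublist q p" "q \<noteq> []"
  shows "vpath q G"
proof -
  obtain xs ys where p: "p = xs @ q @ ys"
    using assms(2) by (auto simp: sublist_def)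
  have "set (vwalk_arcs q) \<subseteq> set (vwalk_arcs p)"
    unfolding p using set_vwalk_arcs_append1 set_vwalk_arcs_append2 by fastforce
  then show ?thesis
    using assms p by (auto simp: vpath_def vwalk_def)
qed

text \<open>A one-vertex walk has no arcs; its vertex is recovered from the start argument
  \<open>hd q\<close>.\<close>

lemma pawalk_verts_vwalk_arcs:
  "q \<noteq> [] \<Longrightarrow> pawalk_verts (hd q) (vwalk_arcs q) = q"
  by (induction q rule: vwalk_arcs.induct) auto

lemma pcas_vwalk_arcs:
  "q \<noteq> [] \<Longrightarrow> pcas (hd q) (vwalk_arcs q) (last q)"
  by (induction q rule: vwalk_arcs.induct) auto

text \<open>With the closing arc in front, the closed walk starts and ends at \<open>last q\<close>,
  and its vertex list after the first entry is exactly \<open>q\<close>, which is distinct.\<close>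

lemma closed_vpath_imp_cycle:
  assumes "vpath q (with_proj G)" "(last q, hd q) \<in> parcs G"
  shows "pre_digraph.cycle (with_proj G) ((last q, hd q) # vwalk_arcs q)"
proof -
  have "q \<noteq> []" "set q \<subseteq> pverts G" "set (vwalk_arcs q) \<subseteq> parcs G" "distinct q"
    using assms(1) by (auto simp: vpath_def vwalk_def)
  then show ?thesis
    using assms(2)
    by (auto simp: pre_digraph.cycle_def pre_digraph.awalk_def cas_with_proj_eq
        awalk_verts_with_proj_eq pawalk_verts_vwalk_arcs pcas_vwalk_arcs intro!: exI[of _ "last q"])
qed

text \<open>Three vertices give at least two arcs, and the closing arc makes three, so the cycle is
  a forbidden one and not a single edge walked back and forth.\<close>

lemma undirected_tree_vpath_ends_not_adjacent:
  assumes "undirected_tree G" "vpath q (with_proj G)" "length q \<ge> 3"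
  shows "{hd q, last q} \<notin> edges G"
proof
  interpret pair_graph G
    using assms(1) by (simp add: undirected_tree_def)
  assume "{hd q, last q} \<in> edges G"
  then have "(last q, hd q) \<in> parcs G"
    by (auto simp: edges_def doubleton_eq_iff intro: arcs_symmetric)
  then have "cycle ((last q, hd q) # vwalk_arcs q)"
    using assms(2) by (rule closed_vpath_imp_cycle[rotated])
  moreover have "length ((last q, hd q) # vwalk_arcs q) \<ge> 3"
    using assms(3) vwalk_length_simp[of q, unfolded vwalk_length_def] by simp
  ultimately show False
    using assms(1) unfolding undirected_tree_def by blast
qed

text \<open>Symmetric differences along consecutive steps add modulo 2. Parities are counted on the
  elements \<open>c a\<close>; the return to colours comes later, from injectivity of
  \<open>c\<close>.\<close>

lemma vwalk_sym_diff:
  assumes step: "\<And>u v. (u, v) \<in> parcs G \<Longrightarrow> sym_diff (\<phi> u) (\<phi> v) = {c (\<kappa> {u, v})}"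
    and "vwalk q (with_proj G)"
  shows "sym_diff (\<phi> (hd q)) (\<phi> (last q)) = {x. odd (count_list (map c (path_word \<kappa> q)) x)}"
  using assms(2)
proof (induction q rule: vwalk_arcs.induct)
  case (3 x y xs)
  let ?r = "path_word \<kappa> (y # xs)"
  have r: "path_word \<kappa> (x # y # xs) = \<kappa> {x, y} # ?r"
    by (simp add: path_word_def)
  have IH: "sym_diff (\<phi> y) (\<phi> (last (y # xs))) = {z. odd (count_list (map c ?r) z)}"
    using 3 by (auto simp: vwalk_def)
  have xy: "sym_diff (\<phi> x) (\<phi> y) = {c (\<kappa> {x, y})}"
    using 3 by (intro step) (auto simp: vwalk_def)
  have l: "last (x # y # xs) = last (y # xs)"
    by simp
  show ?case
    unfolding r l list.sel
  proof (rule set_eqI)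
    \<comment> \<open>Membership of \<open>z\<close> in a symmetric difference is an exclusive or,
      so combining the first edge with the rest of the walk cancels the term for
      \<open>\<phi> y\<close>.\<close>
    fix z
    have "(z \<in> \<phi> y) \<noteq> (z \<in> \<phi> (last (y # xs))) \<longleftrightarrow> odd (count_list (map c ?r) z)"
      using arg_cong[OF IH, of "\<lambda>A. z \<in> A"] by blast
    moreover have "(z \<in> \<phi> x) \<noteq> (z \<in> \<phi> y) \<longleftrightarrow> c (\<kappa> {x, y}) = z"
      using arg_cong[OF xy, of "\<lambda>A. z \<in> A"] by blast
    ultimately show "z \<in> sym_diff (\<phi> x) (\<phi> (last (y # xs)))
        \<longleftrightarrow> z \<in> {z. odd (count_list (map c (\<kappa> {x, y} # ?r)) z)}"
      by (cases "c (\<kappa> {x, y}) = z") (auto simp del: last.simps)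
  qed
qed (auto simp: path_word_def vwalk_def)

lemma set_path_word:
  assumes "proper_edge_coloring G k \<kappa>" "vwalk q (with_proj G)"
  shows "set (path_word \<kappa> q) \<subseteq> {1..k}"
proof -
  have "\<kappa> {u, v} \<in> {1..k}" if "(u, v) \<in> set (vwalk_arcs q)" for u v
  proof -
    have "{u, v} \<in> edges G"
      using assms(2) that by (auto simp: vwalk_def edges_def)
    then show ?thesis
      using assms(1) by (auto simp: proper_edge_coloring_def)
  qed
  then show ?thesis
    by (force simp: path_word_def)
qed

text \<open>This is the parity condition for the full word of a path; applied to every subpath it
  yields the toggle word property.\<close>

lemma generalized_toggle_group_two_odd_colors:
  assumes tree: "undirected_tree G"
    and col: "proper_edge_coloring G k \<kappa>"
    and gtg: "generalized_toggle_group TYPE('e) G k \<kappa>"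
    and q: "vpath q (with_proj G)" "length q \<ge> 3"
  shows "\<exists>a b. a \<noteq> b \<and> odd (count_list (path_word \<kappa> q) a) \<and> odd (count_list (path_word \<kappa> q) b)"
proof -
  interpret pair_graph G
    using tree by (simp add: undirected_tree_def)
  obtain L and \<phi> :: "'a \<Rightarrow> 'e set" and c where
    bij: "bij_betw \<phi> (pverts G) L" and inj: "inj_on c {1..k}"
    and adj: "\<And>u v a. \<lbrakk>u \<in> pverts G; v \<in> pverts G; a \<in> {1..k}; u \<noteq> v\<rbrakk> \<Longrightarrow>
      {u, v} \<in> edges G \<and> \<kappa> {u, v} = a \<longleftrightarrow> sym_diff (\<phi> u) (\<phi> v) = {c a}"
    using gtg unfolding generalized_toggle_group_def by auto
  define w where "w = path_word \<kappa> q"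
  define D where "D = {a. odd (count_list w a)}"
  have vw: "vwalk q (with_proj G)"
    using q(1) by (simp add: vpath_def)
  have wk: "set w \<subseteq> {1..k}"
    unfolding w_def by (rule set_path_word[OF col vw])
  have Dw: "D \<subseteq> set w"
    unfolding D_def by (metis (mono_tags, lifting) count_notin even_zero mem_Collect_eq subsetI)
  \<comment> \<open>Here \<open>adj\<close> is read from left to right; the absence of loops
    supplies \<open>u \<noteq> v\<close>.\<close>
  have step: "sym_diff (\<phi> u) (\<phi> v) = {c (\<kappa> {u, v})}" if "(u, v) \<in> parcs G" for u v
  proof -
    have e: "{u, v} \<in> edges G"
      using that by (auto simp: edges_def)
    then have "\<kappa> {u, v} \<in> {1..k}"
      using col by (auto simp: proper_edge_coloring_def)
    then show ?thesis
      using e adj that wellformed' no_loops' by blast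
  qed
  \<comment> \<open>All letters of \<open>w\<close> lie in \<open>{1..k}\<close>, where
    \<open>c\<close> is injective, so no two colours merge their counts.\<close>
  have count: "count_list (map c w) (c a) = count_list w a" if "a \<in> set w" for a
    using that inj_on_subset[OF inj wk] by (rule count_list_inj_map[rotated])
  have "sym_diff (\<phi> (hd q)) (\<phi> (last q)) = {x. odd (count_list (map c w) x)}"
    unfolding w_def by (rule vwalk_sym_diff[where c = c and \<phi> = \<phi>, OF step vw])
  also have "\<dots> = c ` D"
  proof
    show "{x. odd (count_list (map c w) x)} \<subseteq> c ` D"
    proof
      fix x assume x: "x \<in> {x. odd (count_list (map c w) x)}"
      then have "x \<in> set (map c w)"
        by (metis count_notin even_zero mem_Collect_eq)
      then show "x \<in> c ` D"
        using x count by (auto simp: D_def)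
    qed
    show "c ` D \<subseteq> {x. odd (count_list (map c w) x)}"
      using Dw count by (auto simp: D_def)
  qed
  finally have diff: "sym_diff (\<phi> (hd q)) (\<phi> (last q)) = c ` D" .
  have ends: "hd q \<in> pverts G" "last q \<in> pverts G"
    using vw by (auto simp: vwalk_def)
  have ne: "hd q \<noteq> last q"
    using q by (cases q) (auto simp: vpath_def split: if_splits)
  have "D \<noteq> {}"
  proof
    assume "D = {}"
    then have "\<phi> (hd q) = \<phi> (last q)"
      using diff by auto
    then show False
      using bij ends ne by (auto simp: bij_betw_def inj_on_def)
  qed
  then obtain a where a: "a \<in> D"
    by auto
  \<comment> \<open>For a singleton, \<open>adj\<close> read from right to left turns the
    one-element symmetric difference into an edge between the ends of the path.\<close>
  have "D \<noteq> {a}"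
  proof
    assume "D = {a}"
    moreover have "a \<in> {1..k}"
      using a Dw wk by auto
    ultimately have "{hd q, last q} \<in> edges G"
      using diff adj ends ne by auto
    then show False
      using undirected_tree_vpath_ends_not_adjacent[OF tree q] by simp
  qed
  with a show ?thesis
    by (auto simp: D_def w_def)
qed

theorem theorem4p2:
  fixes G :: "'v pair_pre_digraph" and k :: nat and \<kappa> :: "'v set \<Rightarrow> nat"
    and p :: "'v vwalk"
  assumes "undirected_tree G"
    and "proper_edge_coloring G k \<kappa>"
    and "generalized_toggle_group TYPE('e) G k \<kappa>"
    and "vpath p (with_proj G)"
    and "vwalk_length p \<ge> 2"
  shows "toggle_word k (path_word \<kappa> p)"
  unfolding toggle_word_def
proof (intro conjI allI impI)
  show "set (path_word \<kappa> p) \<subseteq> {1..k}"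
    using set_path_word[OF assms(2), of p] assms(4) by (simp only: vpath_def)
  show "length (path_word \<kappa> p) \<ge> 2"
    using assms(5) by (simp add: length_path_word)
next
  fix s assume s: "sublist s (path_word \<kappa> p) \<and> length s \<ge> 2"
  then obtain q where q: "sublist q p" "path_word \<kappa> q = s"
    using sublist_path_word by blast
  \<comment> \<open>The word has one letter fewer than \<open>q\<close> has vertices, so two letters
    mean at least three vertices.\<close>
  have len: "length q \<ge> 3"
    using s q(2) length_path_word[of \<kappa> q] by auto
  then have "vpath q (with_proj G)"
    by (intro vpath_sublist[OF assms(4) q(1)]) auto
  then show "\<exists>a b. a \<noteq> b \<and> odd (count_list s a) \<and> odd (count_list s b)"
    using generalized_toggle_group_two_odd_colors[OF assms(1-3) _ len] q(2) by simp
qed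

end
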